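(* Let $H$ be a limit sparse semigroup of genus $g$ with even Frobenius number $\ell_g=2g-2r$, where $r$ is a positive integer. Then $H=3\mathbb{N}+H_{6r-2}$.
   Context: $\mathbb{N}$ is the set of natural numbers including $0$. A numerical semigroup $H\subseteq\mathbb{N}$ of genus $g\ge 1$ is a subset containing $0$, closed under addition, whose complement $\mathbb{N}\setminus H=\{1=\ell_1<\ell_2<\dots<\ell_g\}$ has exactly $g$ elements, called gaps; $\ell_g$ is the Frobenius number. $H$ is sparse if $\ell_i-\ell_{i-1}\le 2$ for all $i=2,\dots,g$. A sparse semigroup is a limit sparse semigroup if the number of indices $i\in\{1,\dots,g-1\}$ with $\ell_{i+1}-\ell_i=1$ equals the number of indices $i\in\{1,\dots,g-1\}$ with $\ell_{i+1}-\ell_i=2$; equivalently, $g=2\kappa-1$ where $\kappa:=2g-\ell_g$. For $n\in\mathbb{N}$, $H_n:=\{0,n+1,n+2,\dots\}$; for $m\in\mathbb{N}$, $m\mathbb{N}+H_n:=\{ma+h: a\in\mathbb{N},\,h\in H_n\}$. *)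

theory Defs
  imports Main
begin

definition gaps :: "nat set \<Rightarrow> nat set" where
  "gaps H = UNIV - H"

definition numerical_semigroup :: "nat set \<Rightarrow> bool" where
  "numerical_semigroup H \<longleftrightarrow>
     0 \<in> H \<and> (\<forall>a\<in>H. \<forall>b\<in>H. a + b \<in> H) \<and> finite (gaps H)"

definition genus :: "nat set \<Rightarrow> nat" where
  "genus H = card (gaps H)"

(* gap H i is the i-th gap in increasing order, indexed from 1; it is meaningful
   only for a finite set of gaps and i in {1..genus H}.  On that range it is strictly
   increasing, so the natural-number differences below are not truncated. *)
definition gap :: "nat set \<Rightarrow> nat \<Rightarrow> nat" where
  "gap H i = sorted_list_of_set (gaps H) ! (i - 1)"

definition frobenius_number :: "nat set \<Rightarrow> nat" where
  "frobenius_number H = gap H (genus H)"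

definition sparse_semigroup :: "nat set \<Rightarrow> bool" where
  "sparse_semigroup H \<longleftrightarrow>
     numerical_semigroup H \<and> (\<forall>i\<in>{2..genus H}. gap H i - gap H (i - 1) \<le> 2)"

definition limit_sparse_semigroup :: "nat set \<Rightarrow> bool" where
  "limit_sparse_semigroup H \<longleftrightarrow>
     sparse_semigroup H \<and>
     card {i\<in>{1..<genus H}. gap H (i + 1) - gap H i = 1} =
     card {i\<in>{1..<genus H}. gap H (i + 1) - gap H i = 2}"

definition ordinary_semigroup :: "nat \<Rightarrow> nat set" where
  "ordinary_semigroup n = {0} \<union> {n + 1..}"

definition multiples_plus :: "nat \<Rightarrow> nat set \<Rightarrow> nat set" where
  "multiples_plus m S = {m * a + h | a h. h \<in> S}"

end

theory Submission imports Defs begin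

text \<open>
  Counting the leaps of size 1 and 2 gives \<open>F = 6r - 2\<close> and \<open>g = 4r - 1\<close>, so \<open>H\<close> has \<open>2r = (F + 2)/3\<close>
  elements below the even Frobenius number \<open>F\<close>; this is the largest number possible.

  Let \<open>F - 1, F - 3, \<dots>, F - 2t + 1\<close> be the maximal chain of elements of \<open>H\<close> below \<open>F\<close>, so that both
  \<open>F - 2t - 1\<close> and \<open>F - 2t\<close> are gaps. Every \<open>n \<in> H\<close> up to \<open>F - 2t - 1\<close> yields the pair of consecutive
  gaps \<open>F - 2t - 1 - n, F - 2t - n\<close>, and so does every position strictly between \<open>0\<close> and \<open>m - 1\<close>,
  where \<open>m\<close> is the multiplicity. Sparseness limits the overlap of the two families, and comparing
  with the total number of such pairs gives \<open>m \<le> 2t + 1\<close>. Conversely \<open>m > 2t\<close>, as adding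
  multiples of \<open>m\<close> to \<open>0\<close> would otherwise hit a gap near \<open>F\<close>. So \<open>m = 2t + 1\<close> and all estimates are
  sharp; in particular there are no three consecutive gaps above \<open>m\<close>. For \<open>t \<ge> 2\<close> this forces
  elements between \<open>m\<close> and \<open>2m\<close> whose sum is congruent to a gap near \<open>F\<close>. So \<open>m = 3\<close>, and the
  multiples of \<open>3\<close> already exhaust the elements of \<open>H\<close> below \<open>F\<close>.
\<close>

text \<open>\<open>X\<close> and its shift by one are disjoint, and both lie in an interval of
  length \<open>k + 1\<close>.\<close>

lemma card_no_adjacent:
  fixes X :: "nat set"
  assumes "X \<subseteq> {a..<a + k}" and "\<And>x. x \<in> X \<Longrightarrow> Suc x \<notin> X"
  shows "2 * card X \<le> k + 1"
proof -
  have fin: "finite X" using assms(1) finite_subset by blast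
  have "card (X \<union> Suc ` X) = card X + card (Suc ` X)"
    using fin assms(2) by (intro card_Un_disjoint) auto
  also have "card (Suc ` X) = card X" by (simp add: card_image)
  finally have "2 * card X = card (X \<union> Suc ` X)" by simp
  also have "\<dots> \<le> card {a..<a + k + 1}"
    using assms(1) by (intro card_mono) auto
  finally show ?thesis by simp
qed

text \<open>Sparseness is restated without the list of gaps: since 1 is a gap, a leap above 2
  amounts to two adjacent elements of \<open>H\<close> below \<open>F\<close>.\<close>

locale even_sparse =
  fixes H :: "nat set" and F :: nat
  assumes zero: "0 \<in> H"
    and add: "a \<in> H \<Longrightarrow> b \<in> H \<Longrightarrow> a + b \<in> H"
    and F_notin: "F \<notin> H"
    and above: "F < x \<Longrightarrow> x \<in> H"
    and no_adjacent: "h \<in> H \<Longrightarrow> Suc h \<in> H \<Longrightarrow> F < h"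
    and even_F: "even F"
begin

section \<open>Multiplicity and the chain of elements just below \<open>F\<close>\<close>

definition mult :: nat where
  "mult = (LEAST x. 0 < x \<and> x \<in> H)"

text \<open>The subtraction truncates to \<open>0 \<in> H\<close>, so the minimum is attained at some \<open>t\<close> with \<open>2t + 1 < F\<close>.\<close>
definition chain :: nat where
  "chain = (LEAST t. F - (2 * t + 1) \<notin> H)"

definition leaps :: "nat set" where
  "leaps = {l. l < F \<and> l \<notin> H \<and> Suc l \<notin> H}"

abbreviation small :: "nat set" where
  "small \<equiv> H \<inter> {..F}"

lemma one_notin: "Suc 0 \<notin> H"
  using no_adjacent[OF zero] by auto

lemma F_ge_2: "2 \<le> F"
  using F_notin zero even_F by (cases F; cases "F - 1") auto

lemma mult_in: "mult \<in> H" and mult_pos: "0 < mult"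
proof -
  have "0 < Suc F \<and> Suc F \<in> H" using above by simp
  from LeastI[of "\<lambda>x. 0 < x \<and> x \<in> H", OF this]
  show "mult \<in> H" "0 < mult" by (auto simp: mult_def)
qed

lemma mult_le: "x \<in> H \<Longrightarrow> 0 < x \<Longrightarrow> mult \<le> x"
  unfolding mult_def by (rule Least_le) simp

lemma add_mult: "x \<in> H \<Longrightarrow> x + k * mult \<in> H"
proof (induction k)
  case (Suc k)
  then show ?case using add[OF _ mult_in, of "x + k * mult"] by (simp add: algebra_simps)
qed simp

lemma chain_end: "F - (2 * chain + 1) \<notin> H"
proof -
  obtain k where "F = 2 * k" using even_F by blast
  \<comment> \<open>At \<open>t = k - 1\<close> the descent from \<open>F\<close> arrives at the gap
    1.\<close>
  then have "F - (2 * (k - 1) + 1) \<notin> H" using one_notin F_ge_2 by (simp add: numeral_2_eq_2)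
  then show ?thesis unfolding chain_def by (rule LeastI)
qed

lemma chain_in: "j < chain \<Longrightarrow> F - (2 * j + 1) \<in> H"
  unfolding chain_def using not_less_Least by blast

lemma chain_less: "2 * chain + 1 < F"
proof (rule ccontr)
  assume "\<not> ?thesis"
  then have "F - (2 * chain + 1) = 0" by simp
  then show False using chain_end zero by metis
qed

lemma odd_offset_in: "odd i \<Longrightarrow> i < 2 * chain \<Longrightarrow> F - i \<in> H"
  using chain_in[of "i div 2"] by (auto elim!: oddE)

text \<open>For even \<open>i > 0\<close> the number just above, \<open>F - (i - 1)\<close>, belongs
  to the chain.\<close>

lemma even_offset_notin:
  assumes "even i" "i \<le> 2 * chain"
  shows "F - i \<notin> H"
proof (cases "i = 0")
  case False
  show ?thesis
  proof
    assume "F - i \<in> H"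
    moreover have "F - (i - 1) \<in> H"
      using assms False by (intro odd_offset_in) auto
    moreover have "F - (i - 1) = Suc (F - i)" using False assms chain_less by auto
    ultimately have "F < F - i" using no_adjacent by metis
    then show False by simp
  qed
qed (use F_notin in simp)

lemma offset_in:
  assumes "x \<in> H" "x \<le> F"
  shows "F - (F - x) mod mult \<in> H"
proof -
  have "x + (F - x) div mult * mult = F - (F - x) mod mult"
    using assms(2) div_mult_mod_eq[of "F - x" mult] by linarith
  then show ?thesis using add_mult[OF assms(1)] by metis
qed

text \<open>Otherwise an odd \<open>mult\<close> makes \<open>F - mult\<close> a chain element, so
  \<open>F\<close> is in \<open>H\<close>; an even one carries 0 up to the even offset
  \<open>F mod mult\<close> below \<open>F\<close>, a gap.\<close>

lemma chain_less_mult: "2 * chain < mult"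
proof (rule ccontr)
  assume *: "\<not> ?thesis"
  show False
  proof (cases "even mult")
    case False
    then have "mult < 2 * chain" using * by (metis dvd_triv_left linorder_neqE_nat)
    then have "F - mult \<in> H" using False by (intro odd_offset_in) auto
    then have "F - mult + mult \<in> H" using add mult_in by blast
    then show False using F_notin chain_less * by simp
  next
    case True
    then have "even (F mod mult)" using even_F by (simp add: dvd_mod)
    moreover have "F mod mult \<le> 2 * chain"
      using * mod_less_divisor[OF mult_pos, of F] by linarith
    ultimately show False using even_offset_notin offset_in[OF zero] by simp
  qed
qed

section \<open>Counting pairs of consecutive gaps\<close>

lemma finite_leaps: "finite leaps"
  unfolding leaps_def by simp

text \<open>Each number up to \<open>F\<close> is of exactly one kind: in \<open>H\<close>, one
  above an element of \<open>H\<close>, or the upper of two consecutive gaps.\<close>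

lemma card_leaps: "card leaps + 2 * card small = F + 1"
proof -
  have eq: "{..F} = small \<union> (Suc ` small \<union> Suc ` leaps)"
  proof (intro equalityI subsetI)
    fix x assume "x \<in> {..F}"
    then show "x \<in> small \<union> (Suc ` small \<union> Suc ` leaps)"
      using zero by (cases x) (auto simp: leaps_def)
  next
    fix x assume "x \<in> small \<union> (Suc ` small \<union> Suc ` leaps)"
    then consider "x \<in> small" | y where "x = Suc y" "y \<in> small" | "x \<in> Suc ` leaps"
      by blast
    then show "x \<in> {..F}"
    proof cases
      case (2 y)
      then have "y \<noteq> F" using F_notin by auto
      then show ?thesis using 2 by auto
    qed (auto simp: leaps_def)
  qed
  have "card {..F} = card (small \<union> (Suc ` small \<union> Suc ` leaps))"
    using eq by (rule arg_cong)
  also have "\<dots> = card small + card (Suc ` small \<union> Suc ` leaps)"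
    using no_adjacent finite_leaps
    by (intro card_Un_disjoint) (fastforce simp: leaps_def)+
  also have "card (Suc ` small \<union> Suc ` leaps) = card (Suc ` small) + card (Suc ` leaps)"
    using finite_leaps by (intro card_Un_disjoint) (auto simp: leaps_def)
  finally have "card {..F} = card small + (card (Suc ` small) + card (Suc ` leaps))" .
  then show ?thesis by (simp add: card_image)
qed

section \<open>Pairs of gaps obtained by reflecting \<open>H\<close> at the end of the chain\<close>

definition mirrored :: "nat set" where
  "mirrored = (\<lambda>n. F - (2 * chain + 1) - n) ` (H \<inter> {..F - (2 * chain + 1)})"

lemma mem_mirrored:
  "l \<in> mirrored \<longleftrightarrow> l + (2 * chain + 1) \<le> F \<and> F - (2 * chain + 1) - l \<in> H"
proof
  assume "l + (2 * chain + 1) \<le> F \<and> F - (2 * chain + 1) - l \<in> H"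
  then show "l \<in> mirrored"
    unfolding mirrored_def by (intro image_eqI[of _ _ "F - (2 * chain + 1) - l"]) auto
qed (use chain_less in \<open>auto simp: mirrored_def\<close>)

lemma mirrored_no_adjacent:
  assumes "l \<in> mirrored"
  shows "Suc l \<notin> mirrored"
proof
  assume "Suc l \<in> mirrored"
  then have 1: "Suc l + (2 * chain + 1) \<le> F" "F - (2 * chain + 1) - Suc l \<in> H"
    by (auto simp: mem_mirrored)
  then have "Suc (F - (2 * chain + 1) - Suc l) = F - (2 * chain + 1) - l" by simp
  then have "F < F - (2 * chain + 1) - Suc l"
    using no_adjacent 1(2) assms by (metis mem_mirrored)
  then show False by simp
qed

text \<open>Adding the reflected element to \<open>l\<close> and \<open>Suc l\<close> gives
  \<open>F - (2 * chain + 1)\<close> and \<open>F - 2 * chain\<close>, both gaps.\<close>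

lemma mirrored_subset: "mirrored \<subseteq> leaps"
proof
  fix l assume "l \<in> mirrored"
  then have l: "l + (2 * chain + 1) \<le> F" and n: "F - (2 * chain + 1) - l \<in> H"
    by (auto simp: mem_mirrored)
  have "l \<notin> H"
    using add[OF n, of l] l chain_end by (auto simp: diff_diff_add)
  moreover have "Suc l \<notin> H"
  proof
    assume "Suc l \<in> H"
    then have "F - (2 * chain + 1) - l + Suc l \<in> H" using add n by blast
    moreover have "F - (2 * chain + 1) - l + Suc l = F - 2 * chain" using l by simp
    ultimately have "F - 2 * chain \<in> H" by metis
    then show False using even_offset_notin by simp
  qed
  ultimately show "l \<in> leaps" using l by (simp add: leaps_def)
qed

text \<open>Above \<open>F - (2 * chain + 1)\<close> only odd offsets from \<open>F\<close> lie in
  \<open>H\<close>, and these are the \<open>chain\<close> many chain elements.\<close>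

lemma card_mirrored: "card small = card mirrored + chain"
proof -
  let ?c = "F - (2 * chain + 1)"
  have "small = (H \<inter> {..?c}) \<union> (\<lambda>j. F - (2 * j + 1)) ` {..<chain}"
  proof (intro equalityI subsetI)
    fix x assume x: "x \<in> small"
    show "x \<in> (H \<inter> {..?c}) \<union> (\<lambda>j. F - (2 * j + 1)) ` {..<chain}"
    proof (cases "x \<le> ?c")
      case False
      have "F - (F - x) \<in> H" "F - x \<le> 2 * chain" using x False by auto
      then have "odd (F - x)" using even_offset_notin by blast
      then obtain j where "F - x = 2 * j + 1" by (rule oddE)
      moreover from this have "j < chain" "x = F - (2 * j + 1)" using False x by auto
      ultimately show ?thesis by auto
    qed (use x in auto)
  next
    fix x assume "x \<in> (H \<inter> {..?c}) \<union> (\<lambda>j. F - (2 * j + 1)) ` {..<chain}"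
    then show "x \<in> small" using chain_in by auto
  qed
  moreover have "(H \<inter> {..?c}) \<inter> (\<lambda>j. F - (2 * j + 1)) ` {..<chain} = {}"
    using chain_less by auto
  moreover have "inj_on (\<lambda>j. F - (2 * j + 1)) {..<chain}"
    using chain_less by (intro inj_onI) auto
  moreover have "card mirrored = card (H \<inter> {..?c})"
    unfolding mirrored_def by (intro card_image inj_onI) auto
  ultimately show ?thesis
    by (simp add: card_Un_disjoint card_image)
qed

lemma mult_ge_2: "2 \<le> mult"
  using mult_pos mult_in one_notin by (cases mult; cases "mult - 1") auto

lemma low_leaps: "{1..<mult - 1} \<subseteq> leaps"
proof
  fix l assume l: "l \<in> {1..<mult - 1}"
  have "mult \<le> Suc F" using mult_le above by simp
  moreover have "l \<notin> H" "Suc l \<notin> H" using l mult_le[of l] mult_le[of "Suc l"] by auto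
  ultimately show "l \<in> leaps" using l by (auto simp: leaps_def)
qed

section \<open>The extremal case\<close>

context
  assumes extremal: "3 * card small = F + 2"
begin

lemma card_leaps_extremal: "card leaps + 1 = card mirrored + chain"
  using card_leaps card_mirrored extremal by simp

lemma card_union_inter:
  "card (mirrored \<union> {1..<mult - 1}) + card (mirrored \<inter> {1..<mult - 1})
    = card mirrored + (mult - 2)"
  using card_Un_Int[of mirrored "{1..<mult - 1}"] finite_subset[OF mirrored_subset finite_leaps]
  by simp

lemma card_union_le: "card (mirrored \<union> {1..<mult - 1}) \<le> card leaps"
  using mirrored_subset low_leaps finite_leaps by (intro card_mono) auto

text \<open>At most \<open>(mult - 1) / 2\<close> of the \<open>mult - 2\<close> low positions are
  mirrored, so for \<open>mult > 2 * chain + 1\<close> the union would outgrow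
  \<open>leaps\<close>.\<close>

lemma mult_eq: "mult = 2 * chain + 1"
proof -
  have "2 * card (mirrored \<inter> {1..<mult - 1}) \<le> (mult - 2) + 1"
    using mirrored_no_adjacent mult_ge_2 by (intro card_no_adjacent[of _ 1]) auto
  then have "mult \<le> 2 * chain + 1"
    using card_union_inter card_union_le card_leaps_extremal mult_ge_2 by linarith
  then show ?thesis using chain_less_mult by simp
qed

lemma chain_pos: "0 < chain"
  using mult_eq mult_ge_2 by simp

lemma card_inter_le: "2 * card (mirrored \<inter> {1..<mult - 1}) \<le> 2 * chain"
proof -
  have "2 * card (mirrored \<inter> {1..<mult - 1}) \<le> (mult - 2) + 1"
    using mirrored_no_adjacent mult_ge_2 by (intro card_no_adjacent[of _ 1]) auto
  then show ?thesis using mult_eq chain_pos by linarith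
qed

lemma leaps_eq: "leaps = mirrored \<union> {1..<mult - 1}"
proof -
  have "card leaps \<le> card (mirrored \<union> {1..<mult - 1})"
    using card_union_inter card_inter_le card_leaps_extremal mult_eq chain_pos by linarith
  then show ?thesis
    using mirrored_subset low_leaps finite_leaps by (intro card_seteq[symmetric]) auto
qed

text \<open>Equality in the count puts \<open>chain\<close> non-adjacent mirrored positions among
  \<open>1, ..., 2 * chain - 1\<close>; without 1 only \<open>chain - 1\<close> fit.\<close>

lemma one_mirrored: "1 \<in> mirrored"
proof (rule ccontr)
  assume "1 \<notin> mirrored"
  then have "mirrored \<inter> {1..<mult - 1} \<subseteq> {2..<2 + (2 * chain - 2)}"
    using mult_eq by (auto simp: le_less Suc_le_eq numeral_2_eq_2)
  then have "2 * card (mirrored \<inter> {1..<mult - 1}) \<le> (2 * chain - 2) + 1"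
    using mirrored_no_adjacent by (intro card_no_adjacent) blast+
  then show False
    using card_union_inter card_union_le card_leaps_extremal mult_eq chain_pos by linarith
qed

text \<open>Three consecutive gaps give two adjacent members of \<open>leaps\<close>; from
  \<open>mult - 1\<close> on these are all mirrored, hence never adjacent.\<close>

lemma no_three_gaps:
  assumes "mult \<le> l + 1" "l + 2 \<le> F"
  shows "l \<in> H \<or> l + 1 \<in> H \<or> l + 2 \<in> H"
proof (rule ccontr)
  assume "\<not> ?thesis"
  then have "l \<in> leaps" "Suc l \<in> leaps" using assms by (auto simp: leaps_def)
  then have "l \<in> mirrored" "Suc l \<in> mirrored" using assms(1) by (auto simp: leaps_eq)
  then show False using mirrored_no_adjacent by blast
qed

text \<open>Adding \<open>k\<close> times \<open>mult\<close> to \<open>x\<close> lands on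
  \<open>F - i\<close> with \<open>i <= 2 * chain\<close>, which is a gap for even
  \<open>i\<close>.\<close>

lemma offset_odd:
  assumes "x \<in> H" "x + k * mult + i = F" "i < mult"
  shows "odd i"
  using even_offset_notin[of i] add_mult[OF assms(1), of k] assms(2,3) mult_eq
  by (metis Suc_eq_plus1 add_diff_cancel_right' less_Suc_eq_le)

lemma three_in: "3 \<in> H"
proof (rule ccontr)
  assume "3 \<notin> H"
  then have "mult \<noteq> 3" using mult_in by auto
  then have chain2: "2 \<le> chain" using mult_eq chain_pos by auto
  define q s where "q = F div mult" and "s = F mod mult"
  have F: "F = q * mult + s" and s: "s < mult" by (simp_all add: q_def s_def mult_pos)
  have odd_s: "odd s" using offset_odd[OF zero, of q s] F s by simp
  have odd_mult: "odd mult" using mult_eq by simp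
  have odd_q: "odd q" using even_F odd_s odd_mult by (simp add: F)
  have q1: "q \<noteq> 1"
  proof
    assume "q = 1"
    \<comment> \<open>This element is \<open>s - 1 < mult\<close>, so \<open>s = 1\<close>; then the
      lowest chain element \<open>F - (2 * chain - 1)\<close> equals 3.\<close>
    have "F - (2 * chain + 1) - 1 \<in> H" using one_mirrored mem_mirrored by blast
    moreover have "F = mult + s" using F \<open>q = 1\<close> by simp
    then have "F - (2 * chain + 1) - 1 = s - 1" using mult_eq by linarith
    ultimately have "s - 1 \<in> H" by simp
    then have "\<not> 0 < s - 1" using mult_le[of "s - 1"] s by auto
    then have "s = 1" using odd_pos[OF odd_s] by simp
    moreover have "F - (2 * chain - 1) \<in> H" using chain2 by (intro odd_offset_in) auto
    moreover have "F = mult + s" using F \<open>q = 1\<close> by simp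
    then have "F - (2 * chain - 1) = 3" if "s = 1" using that chain2 mult_eq by linarith
    ultimately have "3 \<in> H" by simp
    then show False using \<open>3 \<notin> H\<close> by simp
  qed
  have "3 \<le> q" using q1 odd_q by (cases q; cases "q - 1"; cases "q - 2") auto
  then obtain p where q: "q = p + 3" by (metis le_add_diff_inverse2)
  have F': "F = p * mult + 3 * mult + s" by (simp add: F q algebra_simps)
  have m5: "5 \<le> mult" using chain2 mult_eq by simp
  have "mult + 1 \<notin> H" using no_adjacent[OF mult_in] F' m5 by auto
  then have "mult + 2 \<in> H \<or> mult + 3 \<in> H"
    using no_three_gaps[of "mult + 1"] F' m5 by (auto simp: numeral_3_eq_3)
  then show False
  proof
    assume *: "mult + 2 \<in> H"
    have "s \<noteq> 1" using offset_odd[OF *, of "p + 1" "mult - 1"] F' m5 odd_mult by auto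
    then have s3: "3 \<le> s" using odd_s by (cases s; cases "s - 1"; cases "s - 2") auto
    \<comment> \<open>\<open>mult + s\<close> and \<open>mult + s + 1\<close> would reach the even
      offsets 0 and \<open>mult - 1\<close>, which leaves \<open>mult + s - 1\<close>; its sum with
      \<open>mult + 2\<close> reaches \<open>mult - 1\<close> again.\<close>
    have "mult + s \<notin> H" using offset_odd[of "mult + s" "p + 2" 0] F' m5 by auto
    moreover have "mult + s + 1 \<notin> H"
      using offset_odd[of "mult + s + 1" "p + 1" "mult - 1"] F' m5 odd_mult by auto
    ultimately have "mult + s - 1 \<in> H"
      using no_three_gaps[of "mult + s - 1"] F' m5 s3 by auto
    then have "mult + 2 + (mult + s - 1) \<in> H" using * add by blast
    moreover have "mult + 2 + (mult + s - 1) + p * mult + (mult - 1) = F"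
      using F' m5 s3 by auto
    ultimately have "odd (mult - 1)" using diff_less[OF zero_less_one mult_pos] by (rule offset_odd)
    then show False using odd_mult by simp
  next
    assume *: "mult + 3 \<in> H"
    have "s < 3"
    proof (rule ccontr)
      assume "\<not> s < 3"
      then have "mult + 3 + (p + 2) * mult + (s - 3) = F" "s - 3 < mult" using F' s by auto
      then have "odd (s - 3)" by (rule offset_odd[OF *])
      then show False using odd_s \<open>\<not> s < 3\<close> by simp
    qed
    then have s1: "s = 1" using odd_s by (cases s; cases "s - 1") auto
    \<comment> \<open>Adjacency to \<open>2 * mult\<close> and the even offset 4 leave only
      \<open>2 * mult - 2\<close>; its sum with \<open>mult + 3\<close> is congruent to
      \<open>F\<close> modulo \<open>mult\<close>.\<close>
    have "2 * mult \<in> H" using add_mult[OF mult_in, of 1] by (simp add: mult_2)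
    then have "2 * mult - 1 \<notin> H" using no_adjacent[of "2 * mult - 1"] F' m5 by auto
    moreover have "2 * mult - 3 \<notin> H"
      using offset_odd[of "2 * mult - 3" "p + 1" 4] F' m5 s1 by auto
    moreover have "2 * mult - 3 + 1 = 2 * mult - 2" "2 * mult - 3 + 2 = 2 * mult - 1"
      and "mult \<le> 2 * mult - 3 + 1" "2 * mult - 3 + 2 \<le> F"
      using F' m5 by auto
    ultimately have "2 * mult - 2 \<in> H" using no_three_gaps[of "2 * mult - 3"] by metis
    then have "mult + 3 + (2 * mult - 2) \<in> H" using * add by blast
    moreover have "mult + 3 + (2 * mult - 2) + p * mult + 0 = F" using F' s1 m5 by auto
    ultimately have "odd (0 :: nat)" using mult_pos by (rule offset_odd)
    then show False by simp
  qed
qed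

text \<open>The multiples of 3 below \<open>F + 2 = 3 * n\<close> are already \<open>n\<close>
  elements of \<open>small\<close>, which has no more.\<close>

lemma small_eq: "x \<le> F \<Longrightarrow> x \<in> H \<longleftrightarrow> 3 dvd x"
proof -
  assume x: "x \<le> F"
  obtain n where n: "F + 2 = 3 * n" using extremal by metis
  have *: "3 * k \<in> H" for k
    by (induction k) (use zero add[OF three_in] in auto)
  have "(*) 3 ` {..<n} = small"
  proof (rule card_seteq)
    show "(*) 3 ` {..<n} \<subseteq> small" using * n by auto
    show "card small \<le> card ((*) 3 ` {..<n})"
      using n extremal by (subst card_image) (auto simp: inj_on_def)
  qed auto
  then have "3 dvd x" if "x \<in> H"
  proof -
    have "x \<in> (*) 3 ` {..<n}" using that x \<open>(*) 3 ` {..<n} = small\<close> by simp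
    then show ?thesis by auto
  qed
  then show "x \<in> H \<longleftrightarrow> 3 dvd x" using * by (auto elim!: dvdE)
qed

end

end

section \<open>Parameters of a limit sparse semigroup\<close>

lemma limit_sparse_even:
  assumes "limit_sparse_semigroup H" "genus H \<ge> 1" "r > 0"
    and "int (frobenius_number H) = 2 * int (genus H) - 2 * int r"
  shows "even_sparse H (6 * r - 2)" "card (H \<inter> {..6 * r - 2}) = 2 * r"
proof -
  define xs where "xs = sorted_list_of_set (gaps H)"
  define g where "g = genus H"
  define F where "F = frobenius_number H"
  have zero: "0 \<in> H" and add: "\<And>a b. a \<in> H \<Longrightarrow> b \<in> H \<Longrightarrow> a + b \<in> H"
    and fin: "finite (gaps H)"
    and sparse: "\<And>i. i \<in> {2..g} \<Longrightarrow> gap H i - gap H (i - 1) \<le> 2"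
    and limit: "card {i \<in> {1..<g}. gap H (i + 1) - gap H i = 1}
        = card {i \<in> {1..<g}. gap H (i + 1) - gap H i = 2}"
    using assms(1)
    by (auto simp: limit_sparse_semigroup_def sparse_semigroup_def numerical_semigroup_def g_def)
  have len: "length xs = g" and set: "set xs = UNIV - H" and sorted: "sorted_wrt (<) xs"
    using fin by (simp_all add: xs_def g_def genus_def gaps_def)
  have g1: "1 \<le> g" using assms(2) by (simp add: g_def)
  have gap: "gap H i = xs ! (i - 1)" for i by (simp add: gap_def xs_def)
  have nth_notin: "xs ! i \<notin> H" if "i < g" for i
    using that nth_mem[of i xs] set len by auto
  have nth_le: "xs ! i \<le> xs ! j" if "i \<le> j" "j < g" for i j
    using that sorted_wrt_nth_less[OF sorted, of i j] len by (cases "i = j") auto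
  have step_gt: "xs ! i < xs ! Suc i" if "Suc i < g" for i
    using that sorted_wrt_nth_less[OF sorted] len by simp
  have step_le: "xs ! Suc i \<le> xs ! i + 2" if "Suc i < g" for i
    using sparse[of "i + 2"] that by (simp add: gap)
  have F: "F = xs ! (g - 1)" by (simp add: F_def frobenius_number_def gap g_def)
  have F_notin: "F \<notin> H" using F nth_notin g1 by simp
  have above: "x \<in> H" if "F < x" for x
  proof (rule ccontr)
    assume "x \<notin> H"
    then obtain i where "i < g" "x = xs ! i" using set len by (metis DiffI UNIV_I in_set_conv_nth)
    then have "x \<le> F" using nth_le[of i "g - 1"] F by simp
    then show False using that by simp
  qed
  have one: "1 \<notin> H"
  proof
    assume "1 \<in> H"
    have "n \<in> H" for n
      by (induction n) (use zero add[OF \<open>1 \<in> H\<close>] in auto)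
    then show False using F_notin by blast
  qed
  have first: "xs ! 0 = 1"
  proof -
    obtain i where "i < g" "xs ! i = 1" using one set len by (metis DiffI UNIV_I in_set_conv_nth)
    then have "xs ! 0 \<le> 1" using nth_le[of 0 i] by simp
    moreover have "xs ! 0 \<noteq> 0" using nth_notin[of 0] g1 zero by (metis One_nat_def Suc_le_eq)
    ultimately show ?thesis by simp
  qed
  \<comment> \<open>No gap can get past \<open>h\<close>: from below \<open>h\<close> the next one
    is at most \<open>h + 1\<close>, and neither \<open>h\<close> nor \<open>h + 1\<close> is a
    gap.\<close>
  have no_adjacent: "F < h" if h: "h \<in> H" "Suc h \<in> H" for h
  proof (rule ccontr)
    assume "\<not> F < h"
    have "xs ! i \<le> h" if "i < g" for i
      using that
    proof (induction i)
      case 0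
      then show ?case using first h one by (cases h) auto
    next
      case (Suc i)
      then have "xs ! i < h" using nth_notin[of i] h(1) by (auto simp: le_less)
      then have "xs ! Suc i \<le> Suc h" using step_le[OF Suc.prems] by simp
      then show ?case using nth_notin[OF Suc.prems] h(2) le_SucE by metis
    qed
    then have "F \<le> h" using F g1 by simp
    then show False using \<open>\<not> F < h\<close> F_notin h(1) by auto
  qed
  define k where "k = card {i \<in> {1..<g}. gap H (i + 1) - gap H i = 1}"
  let ?A = "{i \<in> {1..<g}. gap H (i + 1) - gap H i = 1}"
  let ?B = "{i \<in> {1..<g}. gap H (i + 1) - gap H i = 2}"
  have diff: "gap H (i + 1) - gap H i = 1 \<or> gap H (i + 1) - gap H i = 2" if "i \<in> {1..<g}" for i
    using step_gt[of "i - 1"] step_le[of "i - 1"] that by (auto simp: gap)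
  have part: "{1..<g} = ?A \<union> ?B" using diff by blast
  have disj: "?A \<inter> ?B = {}" by auto
  have "card {1..<g} = card (?A \<union> ?B)" using part by (rule arg_cong)
  also have "\<dots> = card ?A + card ?B" using disj by (intro card_Un_disjoint) auto
  finally have "card {1..<g} = card ?A + card ?B" .
  then have gk: "g = 2 * k + 1" using limit g1 by (simp add: k_def)
  have "(\<Sum>i = 1..<g. gap H (i + 1) - gap H i) = (\<Sum>i\<in>?A \<union> ?B. gap H (i + 1) - gap H i)"
    using part by (rule arg_cong)
  also have "\<dots> = (\<Sum>i\<in>?A. gap H (i + 1) - gap H i) + (\<Sum>i\<in>?B. gap H (i + 1) - gap H i)"
    using disj by (intro sum.union_disjoint) auto
  also have "\<dots> = 3 * k" using limit by (simp add: k_def)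
  finally have sum: "(\<Sum>i = 1..<g. gap H (i + 1) - gap H i) = 3 * k" .
  \<comment> \<open>Telescoping from the first gap 1; \<open>xs\<close> is indexed from 0 but
    \<open>gap\<close> from 1.\<close>
  have "xs ! n = 1 + (\<Sum>i = 1..<Suc n. gap H (i + 1) - gap H i)" if "n < g" for n
    using that
  proof (induction n)
    case (Suc n)
    then show ?case using step_gt[of n] by (simp add: gap)
  qed (simp add: first)
  from this[of "g - 1"] have Fk: "F = 3 * k + 1" using F g1 sum by simp
  \<comment> \<open>Compare \<open>F = 3 * k + 1\<close> with \<open>2 * g - 2 * r\<close> for
    \<open>g = 2 * k + 1\<close>.\<close>
  have kr: "k + 1 = 2 * r" using assms(4) Fk gk by (simp add: F_def g_def)
  have Fr: "F = 6 * r - 2" using Fk kr assms(3) by linarith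
  have "even_sparse H F"
    using zero add F_notin above no_adjacent by unfold_locales (simp_all add: Fr)
  then show "even_sparse H (6 * r - 2)" using Fr by simp
  have "{..F} = (H \<inter> {..F}) \<union> gaps H"
    using above not_le by (auto simp: gaps_def)
  then have "card {..F} = card ((H \<inter> {..F}) \<union> gaps H)" by (rule arg_cong)
  also have "\<dots> = card (H \<inter> {..F}) + card (gaps H)"
    using fin by (intro card_Un_disjoint) (auto simp: gaps_def)
  finally have "card {..F} = card (H \<inter> {..F}) + card (gaps H)" .
  moreover have "card {..F} = 3 * k + 2" by (simp add: Fk)
  moreover have "card (gaps H) = 2 * k + 1" using gk by (simp add: g_def genus_def)
  ultimately have "card (H \<inter> {..F}) = 2 * r" using kr by linarith
  then show "card (H \<inter> {..6 * r - 2}) = 2 * r" by (simp only: Fr)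
qed

section \<open>Membership in the target semigroup, and the conclusion\<close>

lemma multiples_plus_ordinary:
  "x \<in> multiples_plus m (ordinary_semigroup n) \<longleftrightarrow> m dvd x \<or> n < x"
proof
  assume "m dvd x \<or> n < x"
  then show "x \<in> multiples_plus m (ordinary_semigroup n)"
  proof
    assume "m dvd x"
    then obtain a where "x = m * a + 0" by auto
    then show ?thesis unfolding multiples_plus_def ordinary_semigroup_def by blast
  next
    assume "n < x"
    then have "x = m * 0 + x" "x \<in> ordinary_semigroup n" by (auto simp: ordinary_semigroup_def)
    then show ?thesis unfolding multiples_plus_def by blast
  qed
qed (auto simp: multiples_plus_def ordinary_semigroup_def)

theorem theorem3p5:
  fixes H :: "nat set" and g r :: nat
  assumes "limit_sparse_semigroup H"
    and "genus H = g"
    and "g \<ge> 1"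
    and "r > 0"
    and "int (frobenius_number H) = 2 * int g - 2 * int r"
  shows "H = multiples_plus 3 (ordinary_semigroup (6 * r - 2))"
proof -
  note params = assms(1) assms(3)[folded assms(2)] assms(4) assms(5)[folded assms(2)]
  interpret even_sparse H "6 * r - 2"
    using params by (rule limit_sparse_even)
  have "card (H \<inter> {..6 * r - 2}) = 2 * r"
    using params by (rule limit_sparse_even)
  \<comment> \<open>The extremal hypothesis for \<open>F = 6 * r - 2\<close>; \<open>r > 0\<close>
    keeps the subtraction exact.\<close>
  then have "3 * card (H \<inter> {..6 * r - 2}) = (6 * r - 2) + 2" using assms(4) by simp
  note small_iff = small_eq[OF this]
  have "x \<in> H \<longleftrightarrow> x \<in> multiples_plus 3 (ordinary_semigroup (6 * r - 2))" for x
    unfolding multiples_plus_ordinary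
    using small_iff[of x] above[of x] by (cases "x \<le> 6 * r - 2") auto
  then show ?thesis by (rule set_eqI)
qed

end
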